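(* For any $n\ge1$, any dual quaternion Hermitian matrix $A\in\hat{\mathbb H}^{n\times n}$ and any dual quaternion unitary matrix $U\in\hat{\mathbb H}^{n\times n}$, we have $$\mathrm{Cdet}(U^*AU)=\mathrm{Cdet}(A),$$ where $\mathrm{Cdet}$ is the Chen determinant.
   Context: $\mathbb H$ denotes the real quaternions with conjugation $q\mapsto q^*$. A dual quaternion is $q=q_s+q_d\epsilon$ with $q_s,q_d\in\mathbb H$, where $\epsilon\neq 0$, $\epsilon^2=0$, and $\epsilon$ commutes with all quaternions; the set of dual quaternions is $\hat{\mathbb H}$, and $q^*=q_s^*+q_d^*\epsilon$. For $A=(a_{ij})\in\hat{\mathbb H}^{n\times n}$, $A^*=(a_{ji}^* )$; $A$ is Hermitian if $A^*=A$, and unitary if $A^*A=I_n$. Chen determinant: write a permutation $\sigma$ of $\{1,\dots,n\}$ as an ordered product of disjoint cycles (fixed points included) $$\sigma=(n_{11}\cdots n_{1l_1})(n_{21}\cdots n_{2l_2})\cdots(n_{r1}\cdots n_{rl_r}),$$ where $(i_1\cdots i_k)$ means $i_1\mapsto i_2\mapsto\cdots\mapsto i_k\mapsto i_1$, arranged (uniquely) so that $n_{i1}>n_{ij}$ for all $j>1$ and $i=1,\dots,r$, and $n=n_{11}>n_{21}>\cdots>n_{r1}$. Set $$a_\sigma=(a_{n_{11}n_{12}}a_{n_{12}n_{13}}\cdots a_{n_{1l_1}n_{11}})(a_{n_{21}n_{22}}\cdots a_{n_{2l_2}n_{21}})\cdots(a_{n_{r1}n_{r2}}\cdots a_{n_{rl_r}n_{r1}})$$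 (product in the indicated order). For an arbitrary $A=(a_{ij})\in\hat{\mathbb H}^{n\times n}$, $\mathrm{Cdet}(A)=\sum_\sigma(-1)^{n-r}a_\sigma$, summed over all permutations $\sigma$ of $\{1,\dots,n\}$, where $r$ is the number of cycles of $\sigma$. *)

theory Defs
  imports "Jordan_Normal_Form.Matrix" "HOL-Combinatorics.Cycles" Complex_Main
begin

section \<open>Quaternions\<close>

datatype quat = Quat (qRe: real) (qI: real) (qJ: real) (qK: real)

instantiation quat :: ring_1
begin

definition "0 = Quat 0 0 0 0"

definition "1 = Quat 1 0 0 0"

definition "p + q = Quat (qRe p + qRe q) (qI p + qI q) (qJ p + qJ q) (qK p + qK q)"

definition "- q = Quat (- qRe q) (- qI q) (- qJ q) (- qK q)"

definition "p - q = Quat (qRe p - qRe q) (qI p - qI q) (qJ p - qJ q) (qK p - qK q)"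

text \<open>Hamilton's product, from \<open>i\<^sup>2 = j\<^sup>2 = k\<^sup>2 = ijk = - 1\<close>.\<close>

definition "p * q = Quat
  (qRe p * qRe q - qI p * qI q - qJ p * qJ q - qK p * qK q)
  (qRe p * qI q + qI p * qRe q + qJ p * qK q - qK p * qJ q)
  (qRe p * qJ q - qI p * qK q + qJ p * qRe q + qK p * qI q)
  (qRe p * qK q + qI p * qJ q - qJ p * qI q + qK p * qRe q)"

instance
  by standard
    (simp_all add: zero_quat_def one_quat_def plus_quat_def uminus_quat_def minus_quat_def
      times_quat_def quat.expand algebra_simps)

end

definition qcnj :: "quat \<Rightarrow> quat" where
  "qcnj q = Quat (qRe q) (- qI q) (- qJ q) (- qK q)"


section \<open>Dual quaternions\<close>

text \<open>\<open>DQuat a b\<close> is \<open>a + b \<epsilon>\<close>; see \<open>DQuat_eq\<close> below.\<close>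

datatype dquat = DQuat (dq_std: quat) (dq_dual: quat)

instantiation dquat :: ring_1
begin

definition "0 = DQuat 0 0"

definition "1 = DQuat 1 0"

definition "p + q = DQuat (dq_std p + dq_std q) (dq_dual p + dq_dual q)"

definition "- q = DQuat (- dq_std q) (- dq_dual q)"

definition "p - q = DQuat (dq_std p - dq_std q) (dq_dual p - dq_dual q)"

definition "p * q = DQuat (dq_std p * dq_std q) (dq_std p * dq_dual q + dq_dual p * dq_std q)"

instance
  by standard
    (simp_all add: zero_dquat_def one_dquat_def plus_dquat_def uminus_dquat_def minus_dquat_def
      times_dquat_def dquat.expand algebra_simps)

end

definition dq_of_quat :: "quat \<Rightarrow> dquat" where
  "dq_of_quat a = DQuat a 0"

definition dq_eps :: dquat where
  "dq_eps = DQuat 0 1"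

lemma dq_eps_nonzero: "dq_eps \<noteq> 0"
  by (simp add: dq_eps_def zero_dquat_def)

lemma dq_eps_square: "dq_eps * dq_eps = 0"
  by (simp add: dq_eps_def times_dquat_def zero_dquat_def)

lemma dq_eps_commutes: "dq_eps * dq_of_quat a = dq_of_quat a * dq_eps"
  by (simp add: dq_eps_def dq_of_quat_def times_dquat_def)

lemma DQuat_eq: "DQuat a b = dq_of_quat a + dq_of_quat b * dq_eps"
  by (simp add: dq_eps_def dq_of_quat_def times_dquat_def plus_dquat_def)

definition dqcnj :: "dquat \<Rightarrow> dquat" where
  "dqcnj q = DQuat (qcnj (dq_std q)) (qcnj (dq_dual q))"


section \<open>Dual quaternion matrices\<close>

definition dq_adjoint :: "dquat mat \<Rightarrow> dquat mat" where
  "dq_adjoint A = map_mat dqcnj (transpose_mat A)"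

definition dq_hermitian :: "dquat mat \<Rightarrow> bool" where
  "dq_hermitian A \<longleftrightarrow> dq_adjoint A = A"

definition dq_unitary :: "dquat mat \<Rightarrow> bool" where
  "dq_unitary U \<longleftrightarrow> square_mat U \<and> dq_adjoint U * U = 1\<^sub>m (dim_row U)"


section \<open>Chen determinant\<close>

text \<open>Matrix indices run over \<open>{..<n}\<close> rather than \<open>{1..n}\<close>. The shift preserves
  the order, so only the names of the indices change.

  \<open>is_chen_form n p cs\<close>: the list \<open>cs\<close> of cycles is an ordered cycle decomposition of \<open>p\<close>,
  fixed points included, each cycle starting at its largest element and the cycles being
  listed by decreasing first element.\<close>

definition is_chen_form :: "nat \<Rightarrow> (nat \<Rightarrow> nat) \<Rightarrow> nat list list \<Rightarrow> bool" where
  "is_chen_form n p cs \<longleftrightarrow>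
     distinct (concat cs) \<and> set (concat cs) = {..<n} \<and>
     (\<forall>c \<in> set cs. c \<noteq> [] \<and> map p c = rotate1 c \<and> (\<forall>x \<in> set (tl c). x < hd c)) \<and>
     sorted_wrt (>) (map hd cs)"

text \<open>\<open>support p m\<close> is the list \<open>[m, p m, p (p m), \<dots>]\<close> running once through the cycle of \<open>m\<close>.\<close>

definition chen_leaders :: "nat \<Rightarrow> (nat \<Rightarrow> nat) \<Rightarrow> nat set" where
  "chen_leaders n p = {m. m < n \<and> (\<forall>x \<in> set (support p m). x \<le> m)}"

definition chen_cycles :: "nat \<Rightarrow> (nat \<Rightarrow> nat) \<Rightarrow> nat list list" where
  "chen_cycles n p = map (support p) (rev (sorted_list_of_set (chen_leaders n p)))"

definition cycle_product :: "'a :: ring_1 mat \<Rightarrow> nat list \<Rightarrow> 'a" where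
  "cycle_product A c = prod_list (map2 (\<lambda>i j. A $$ (i, j)) c (rotate1 c))"

definition Cdet :: "'a :: ring_1 mat \<Rightarrow> 'a" where
  "Cdet A = (\<Sum>p | p permutes {..<dim_row A}.
     (- 1) ^ (dim_row A - length (chen_cycles (dim_row A) p)) *
     prod_list (map (cycle_product A) (chen_cycles (dim_row A) p)))"

subsection \<open>The arrangement exists and is unique\<close>

lemma chen_form_cycle_eq_support:
  assumes "distinct c" "c \<noteq> []" "map p c = rotate1 c"
  shows "c = support p (hd c)"
proof -
  have step: "p (c ! i) = c ! (Suc i mod length c)" if "i < length c" for i
    using arg_cong[OF assms(3), of "\<lambda>l. l ! i"] that by (simp add: nth_rotate1)
  have pw: "(p ^^ i) (hd c) = c ! (i mod length c)" for i
  proof (induction i)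
    case 0
    then show ?case using assms(2) by (simp add: hd_conv_nth)
  next
    case (Suc i)
    have "(p ^^ Suc i) (hd c) = p (c ! (i mod length c))" using Suc by simp
    also have "\<dots> = c ! (Suc (i mod length c) mod length c)"
      using assms(2) by (intro step) simp
    finally show ?case by (simp add: mod_Suc_eq)
  qed
  have lp: "least_power p (hd c) = length c"
    unfolding least_power_def
  proof (rule Least_equality)
    show "(p ^^ length c) (hd c) = hd c \<and> 0 < length c"
      using assms(2) unfolding pw by (simp add: hd_conv_nth)
  next
    fix k assume k: "(p ^^ k) (hd c) = hd c \<and> 0 < k"
    show "length c \<le> k"
    proof (rule ccontr)
      assume "\<not> length c \<le> k"
      then have "c ! k = c ! 0" using k assms(2) unfolding pw by (simp add: hd_conv_nth)
      then show False
        using assms(1,2) k \<open>\<not> length c \<le> k\<close> nth_eq_iff_index_eq[of c k 0] by simp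
    qed
  qed
  show ?thesis
    by (rule nth_equalityI) (simp_all add: lp pw)
qed

lemma map_support_eq_rotate1:
  assumes "permutation p"
  shows "map p (support p a) = rotate1 (support p a)"
proof (rule nth_equalityI)
  note lp = least_power_of_permutation[OF assms, of a]
  show "map p (support p a) ! i = rotate1 (support p a) ! i"
    if "i < length (map p (support p a))" for i
  proof (cases "Suc i = least_power p a")
    case True
    then have e: "p ((p ^^ i) a) = a" using lp(1) by (metis funpow.simps(2) o_apply)
    have "i < least_power p a" using True by simp
    then show ?thesis using lp(2) by (simp add: nth_rotate1 True e)
  next
    case False
    then show ?thesis using that by (simp add: nth_rotate1)
  qed
qed simp

lemma is_chen_form_iff:
  assumes p: "p permutes {..<n}"
  shows "is_chen_form n p cs \<longleftrightarrow> cs = chen_cycles n p"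
proof -
  let ?L = "chen_leaders n p"
  have perm: "permutation p" using p by (auto simp: permutation_permutes)
  note lp = least_power_of_permutation[OF perm]
  have fin: "finite ?L" by (simp add: chen_leaders_def)
  have ne: "support p a \<noteq> []" for a using lp(2)[of a] by simp
  have hd: "hd (support p a) = a" for a using lp(2)[of a] by (simp add: hd_map)
  have self: "a \<in> set (support p a)" for a using ne hd by (metis hd_in_set)
  have sub: "x < n" if "a < n" "x \<in> set (support p a)" for a x
    using that permutes_in_image[OF permutes_funpow[OF p]] by auto
  have same: "set (support p a) = set (support p b)" if "a \<in> set (support p b)" for a b
    using disjoint_support[OF perm] self[of a] that unfolding disjoint_def by blast
  have leader: "\<exists>m \<in> ?L. a \<in> set (support p m)" if "a < n" for a
  proof -
    let ?m = "Max (set (support p a))"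
    have m: "?m \<in> set (support p a)" using ne[of a] by (intro Max_in) auto
    have e: "set (support p ?m) = set (support p a)" using same[OF m] .
    have "?m < n" using sub[OF that m] .
    moreover have "x \<le> ?m" if "x \<in> set (support p ?m)" for x
      using that unfolding e by (intro Max_ge) auto
    ultimately have "?m \<in> ?L" unfolding chen_leaders_def by blast
    moreover have "a \<in> set (support p ?m)" using self e by blast
    ultimately show ?thesis by blast
  qed
  have distL: "a = b" if "a \<in> ?L" "b \<in> ?L" "set (support p a) \<inter> set (support p b) \<noteq> {}" for a b
  proof -
    have "a \<in> set (support p b)" using disjoint_support'[OF perm] that(3) by blast
    then have e: "set (support p a) = set (support p b)" by (rule same)
    have "a \<le> b" using that(2) self[of a] e unfolding chen_leaders_def by blast
    moreover have "b \<le> a" using that(1) self[of b] e unfolding chen_leaders_def by blast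
    ultimately show ?thesis by simp
  qed
  have set_cycles: "set (chen_cycles n p) = support p ` ?L"
    unfolding chen_cycles_def by (simp only: set_map set_rev set_sorted_list_of_set[OF fin])
  have "is_chen_form n p (chen_cycles n p)"
    unfolding is_chen_form_def
  proof (intro conjI ballI)
    show "distinct (concat (chen_cycles n p))"
    proof (rule distinct_concat)
      have "inj_on (support p) S" for S
        by (rule inj_on_inverseI[where g = hd]) (rule hd)
      then show "distinct (chen_cycles n p)"
        unfolding chen_cycles_def distinct_map by simp
      show "distinct ys" if "ys \<in> set (chen_cycles n p)" for ys
      proof -
        from that obtain a where "ys = support p a" unfolding set_cycles by (elim imageE)
        then show ?thesis using cycle_of_permutation[OF perm] by simp
      qed
      show "set ys \<inter> set zs = {}"
        if "ys \<in> set (chen_cycles n p)" "zs \<in> set (chen_cycles n p)" "ys \<noteq> zs" for ys zs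
      proof -
        from that(1) obtain a where a: "a \<in> ?L" "ys = support p a"
          unfolding set_cycles by (rule imageE)
        from that(2) obtain b where b: "b \<in> ?L" "zs = support p b"
          unfolding set_cycles by (rule imageE)
        have "a \<noteq> b" using a(2) b(2) that(3) by blast
        then show ?thesis using distL[OF a(1) b(1)] unfolding a(2) b(2) by blast
      qed
    qed
    have "set (concat (chen_cycles n p)) = (\<Union>m \<in> ?L. set (support p m))"
      unfolding set_concat set_cycles by (simp only: image_image UN_simps)
    also have "\<dots> = {..<n}"
    proof
      show "(\<Union>m \<in> ?L. set (support p m)) \<subseteq> {..<n}"
        using sub unfolding chen_leaders_def by blast
      show "{..<n} \<subseteq> (\<Union>m \<in> ?L. set (support p m))"
        using leader by blast
    qed
    finally show "set (concat (chen_cycles n p)) = {..<n}" .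
    show "sorted_wrt (>) (map hd (chen_cycles n p))"
    proof -
      have "map hd (chen_cycles n p) = rev (sorted_list_of_set ?L)"
        unfolding chen_cycles_def by (simp only: map_map comp_def hd map_ident)
      then show ?thesis by (simp add: sorted_wrt_rev)
    qed
    fix c assume "c \<in> set (chen_cycles n p)"
    then obtain a where a: "a \<in> ?L" "c = support p a"
      unfolding set_cycles by (rule imageE)
    show "c \<noteq> []" unfolding a(2) by (rule ne)
    show "map p c = rotate1 c" unfolding a(2) by (rule map_support_eq_rotate1[OF perm])
    fix x assume x: "x \<in> set (tl c)"
    have "c = hd c # tl c" using \<open>c \<noteq> []\<close> by simp
    moreover have "distinct c" unfolding a(2) using cycle_of_permutation[OF perm] .
    ultimately have "x \<noteq> hd c" using x by (metis distinct.simps(2))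
    moreover have "x \<le> a"
      using x a list.set_sel(2)[OF \<open>c \<noteq> []\<close>] unfolding chen_leaders_def by blast
    moreover have "hd c = a" unfolding a(2) by (rule hd)
    ultimately show "x < hd c" by simp
  qed
  moreover have "cs = chen_cycles n p" if cf: "is_chen_form n p cs"
  proof -
    have c: "c = support p (hd c)" if "c \<in> set cs" for c
      using cf that unfolding is_chen_form_def
      by (intro chen_form_cycle_eq_support) (auto simp: distinct_concat_iff)
    have bound: "x \<le> hd c" if "c \<in> set cs" "x \<in> set c" for c x
    proof -
      have "c \<noteq> []" "\<forall>y \<in> set (tl c). y < hd c" using cf that(1) unfolding is_chen_form_def by auto
      then show ?thesis using that(2) by (cases c) auto
    qed
    have "set (map hd cs) = ?L"
    proof (intro equalityI subsetI)
      fix m assume "m \<in> set (map hd cs)"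
      then obtain d where d: "d \<in> set cs" "m = hd d" by auto
      have "d \<noteq> []" using cf d(1) unfolding is_chen_form_def by auto
      then have "m \<in> set d" using d(2) by simp
      then have "m \<in> set (concat cs)" using d(1) by auto
      then have "m < n" using cf unfolding is_chen_form_def by blast
      moreover have "x \<le> m" if "x \<in> set (support p m)" for x
        using bound[OF d(1)] that c[OF d(1)] d(2) by simp
      ultimately show "m \<in> ?L" unfolding chen_leaders_def by blast
    next
      fix m assume m: "m \<in> ?L"
      then have "m \<in> set (concat cs)"
        using cf unfolding is_chen_form_def chen_leaders_def by blast
      then obtain d where d: "d \<in> set cs" "m \<in> set d" by auto
      have "set (support p m) = set d" using same[of m "hd d"] c[OF d(1)] d(2) by simp
      moreover have "d \<noteq> []" using d(2) by auto
      ultimately have "hd d \<in> set (support p m)" using hd_in_set by blast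
      then have "hd d \<le> m" using m unfolding chen_leaders_def by blast
      then have "m = hd d" using bound[OF d] by simp
      then show "m \<in> set (map hd cs)" using d(1) by simp
    qed
    moreover have "sorted_wrt (<) (rev (map hd cs))"
      using cf unfolding is_chen_form_def sorted_wrt_rev by simp
    ultimately have "rev (map hd cs) = sorted_list_of_set ?L"
      by (metis set_rev strict_sorted_equal strict_sorted_list_of_set fin set_sorted_list_of_set)
    then have "map hd cs = rev (sorted_list_of_set ?L)" by (metis rev_rev_ident)
    moreover have "map (support p) (map hd cs) = cs"
      unfolding map_map by (rule map_idI) (use c in simp)
    ultimately show ?thesis unfolding chen_cycles_def by metis
  qed
  ultimately show ?thesis by blast
qed

end

theory Submission
  imports Defs
begin

text \<open>The Chen determinant of a Hermitian matrix can be expressed through quantities that are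
  visibly invariant, the real parts of the traces of the powers \<open>A\<^sup>k\<close>.

  Reversing a cycle of a Hermitian matrix conjugates its cycle product, and the sum of a product
  and its conjugate is twice its real part, a dual number, which is central. Pairing each cycle
  with its reverse, starting from the last cycle of the Chen order, therefore replaces every
  cycle product by its real part (\<open>chen_sum_cycle_product_hermitian\<close>). As \<open>Re (x y) = Re (y x)\<close>,
  the real part of a cycle product does not depend on the starting point of the cycle, so all
  ordering conventions become irrelevant: the determinant can be expanded along the cycle through
  any index (\<open>chen_sum_eq_pivot_sum\<close>) and is unchanged by a renaming of the indices
  (\<open>chen_sum_relabel\<close>).

  The next point is that the determinant of the matrix \<open>(a\<^bsub>f i, f j\<^esub>)\<close> vanishes when \<open>f i = f j\<close> for
  some \<open>i \<noteq> j\<close>. Permutations having \<open>i\<close> and \<open>j\<close> in different cycles \<open>(i u)(j v)\<close> are matched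
  with those having them in one cycle \<open>(i u j v)\<close>; with \<open>x\<close>, \<open>y\<close> the products along the two
  loops, the matched terms add up to \<open>Re x Re y - Re (x y)\<close>, and this cancels against the same
  term for the reversed loop \<open>v\<close> because \<open>Re (x y) + Re (x y\<^sup>*) = 2 Re x Re y\<close>
  (\<open>double_chen_sum_eq_0\<close>).

  Hence the sum of the determinants of \<open>(a\<^bsub>f i, f j\<^esub>)\<close> over all maps \<open>f\<close> of the index set to itself
  equals the number of permutations times the determinant of \<open>A\<close>. But in this sum
  the indices run freely, so every cycle of length \<open>k\<close> contributes the real trace of \<open>A\<^sup>k\<close>
  (\<open>total_chen_sum_rec\<close>). These traces agree for \<open>A\<close> and \<open>U\<^sup>* A U\<close> as soon as \<open>U U\<^sup>* = I\<close>, which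
  follows from \<open>U\<^sup>* U = I\<close> by positivity: \<open>I - U U\<^sup>*\<close> is a Hermitian idempotent with vanishing
  real trace (\<open>dq_unitary_mult_adjoint\<close>).\<close>

section \<open>Chen determinants as sums over lists of cycles\<close>

definition arrangements :: "'a set \<Rightarrow> 'a list set" where
  "arrangements S = {w. distinct w \<and> set w \<subseteq> S}"

lemma finite_arrangements: "finite S \<Longrightarrow> finite (arrangements S)"
  unfolding arrangements_def by (rule finite_subset[OF _ finite_subset_distinct]) auto

text \<open>The lists that \<open>is_chen_form\<close> admits, with no reference to a permutation and for an
  arbitrary set of indices in place of \<open>{..<n}\<close>. Removing a cycle from such a list leaves a list
  of the same kind on the remaining indices, which makes recursion possible.\<close>

definition chen_forms :: "nat set \<Rightarrow> nat list list set" where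
  "chen_forms S = {cs. distinct (concat cs) \<and> set (concat cs) = S \<and>
     (\<forall>c \<in> set cs. c \<noteq> [] \<and> (\<forall>x \<in> set (tl c). x < hd c)) \<and> sorted_wrt (>) (map hd cs)}"

text \<open>An arbitrary weight \<open>t\<close> on cycles lets the Chen determinant and its counterpart with real parts
  of cycle products share one recursion.\<close>

definition chen_sum :: "(nat list \<Rightarrow> 'a::ring_1) \<Rightarrow> nat set \<Rightarrow> 'a" where
  "chen_sum t S = (\<Sum>cs\<in>chen_forms S. (- 1) ^ (card S - length cs) * prod_list (map t cs))"

lemma chen_forms_empty: "chen_forms {} = {[]}"
proof -
  have "cs = []" if "cs \<in> chen_forms {}" for cs
    using that by (cases cs) (auto simp: chen_forms_def)
  then show ?thesis by (auto simp: chen_forms_def)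
qed

lemma chen_sum_empty [simp]: "chen_sum t {} = 1"
  by (simp add: chen_sum_def chen_forms_empty)

lemma chen_forms_infinite: "infinite S \<Longrightarrow> chen_forms S = {}"
  by (auto simp: chen_forms_def)

lemma length_le_card_if_chen_form:
  assumes "cs \<in> chen_forms S"
  shows "length cs \<le> card S"
proof -
  have d: "distinct (concat cs)" and s: "set (concat cs) = S" and ne: "\<forall>c\<in>set cs. c \<noteq> []"
    using assms by (auto simp: chen_forms_def)
  have "length cs \<le> length (concat cs)"
    using ne
  proof (induction cs)
    case (Cons c cs)
    then have "length c \<ge> 1" by (cases c) auto
    with Cons show ?case by simp
  qed simp
  also have "\<dots> = card S" using distinct_card[OF d] s by simp
  finally show ?thesis .
qed

text \<open>The first cycle of a Chen form is the one through the largest index, which it starts with.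
  What follows this index in the cycle is free.\<close>

lemma chen_form_Cons_iff:
  assumes "finite S" "S \<noteq> {}"
  shows "c # cs \<in> chen_forms S \<longleftrightarrow>
     (\<exists>w \<in> arrangements (S - {Max S}). c = Max S # w \<and> cs \<in> chen_forms (S - insert (Max S) (set w)))"
    (is "?L \<longleftrightarrow> ?R")
proof
  assume L: ?L
  then have ne: "c \<noteq> []" and lt: "\<forall>x\<in>set (tl c). x < hd c"
    and dist: "distinct (concat (c # cs))" and un: "set (concat (c # cs)) = S"
    and so: "sorted_wrt (>) (map hd (c # cs))"
    and rest: "\<forall>c\<in>set cs. c \<noteq> [] \<and> (\<forall>x\<in>set (tl c). x < hd c)"
    by (auto simp: chen_forms_def)
  have c: "c = hd c # tl c" using ne by simp
  have le: "x \<le> hd c" if "x \<in> S" for x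
  proof -
    from that un consider "x \<in> set c" | d where "d \<in> set cs" "x \<in> set d" by auto
    then show ?thesis
    proof cases
      case 1
      then have "x = hd c \<or> x \<in> set (tl c)" using c by (metis set_ConsD)
      then show ?thesis using lt by auto
    next
      case 2
      then have "d = hd d # tl d" by (metis hd_Cons_tl empty_iff list.set(1))
      then have "x = hd d \<or> x \<in> set (tl d)" using 2 by (metis set_ConsD)
      then have "x \<le> hd d" using rest 2 by (auto intro: less_imp_le)
      also have "hd d < hd c" using so 2 by auto
      finally show ?thesis by simp
    qed
  qed
  have "hd c \<in> S" using un ne by auto
  then have m: "hd c = Max S" using le assms by (metis Max_eqI)
  have "set (tl c) \<subseteq> S - {Max S}" using un lt m
    by (auto dest: list.set_sel(2)[OF ne])
  moreover have "distinct (tl c)" using dist by (simp add: distinct_tl)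
  ultimately have "tl c \<in> arrangements (S - {Max S})" by (simp add: arrangements_def)
  moreover have "set c = insert (Max S) (set (tl c))" using c m by (metis list.set(2))
  then have "cs \<in> chen_forms (S - insert (Max S) (set (tl c)))"
    using dist un so rest unfolding chen_forms_def by auto
  ultimately show ?R using c m by metis
next
  assume ?R
  then obtain w where w: "w \<in> arrangements (S - {Max S})" "c = Max S # w"
    and cs: "cs \<in> chen_forms (S - insert (Max S) (set w))" by blast
  have mS: "Max S \<in> S" using assms by simp
  have less: "x < Max S" if "x \<in> S - {Max S}" for x
    using that assms by (simp add: order.not_eq_order_implies_strict)
  have hd: "hd d \<in> S - {Max S}" if "d \<in> set cs" for d
  proof -
    have "d \<noteq> []" "set d \<subseteq> S - {Max S}" using cs that by (auto simp: chen_forms_def)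
    then show ?thesis by (cases d) auto
  qed
  have "set (concat (c # cs)) = S"
    using w cs mS by (auto simp: chen_forms_def arrangements_def)
  moreover have "distinct (concat (c # cs))"
    using w cs by (auto simp: chen_forms_def arrangements_def)
  moreover have "\<forall>c\<in>set (c # cs). c \<noteq> [] \<and> (\<forall>x\<in>set (tl c). x < hd c)"
    using w cs less by (auto simp: chen_forms_def arrangements_def)
  moreover have "sorted_wrt (>) (map hd (c # cs))"
    using w cs less hd by (auto simp: chen_forms_def)
  ultimately show ?L by (simp add: chen_forms_def)
qed

lemma chen_forms_rec:
  assumes "finite S" "S \<noteq> {}"
  shows "bij_betw (\<lambda>(w, cs). (Max S # w) # cs)
    (SIGMA w:arrangements (S - {Max S}). chen_forms (S - insert (Max S) (set w))) (chen_forms S)"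
  unfolding bij_betw_def
proof
  show "inj_on (\<lambda>(w, cs). (Max S # w) # cs)
    (SIGMA w:arrangements (S - {Max S}). chen_forms (S - insert (Max S) (set w)))"
    by (auto simp: inj_on_def)
  have "\<exists>c cs'. cs = c # cs'" if "cs \<in> chen_forms S" for cs
    using that assms(2) by (cases cs) (auto simp: chen_forms_def)
  then show "(\<lambda>(w, cs). (Max S # w) # cs) `
    (SIGMA w:arrangements (S - {Max S}). chen_forms (S - insert (Max S) (set w))) = chen_forms S"
    using chen_form_Cons_iff[OF assms] by (fastforce simp: image_iff)
qed

lemma finite_chen_forms: "finite (chen_forms S)"
proof (cases "finite S")
  case True
  then show ?thesis
  proof (induction "card S" arbitrary: S rule: less_induct)
    case less
    show ?case
    proof (cases "S = {}")
      case False
      have "card (S - insert (Max S) (set w)) < card S" for w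
        using less.prems False by (intro psubset_card_mono) (auto dest: Max_in)
      then have "finite (chen_forms (S - insert (Max S) (set w)))" for w
        using less by blast
      then show ?thesis
        using bij_betw_finite[OF chen_forms_rec[OF less.prems False]] finite_arrangements less.prems
        by blast
    qed (simp add: chen_forms_empty)
  qed
qed (simp add: chen_forms_infinite)

text \<open>The expansion of a Chen sum along the cycle through \<open>m\<close>: a cycle \<open>m # w\<close> has sign
  \<open>(- 1) ^ length w\<close>, and the rest of the permutation lives on the remaining indices.\<close>

definition pivot_sum :: "(nat list \<Rightarrow> 'a::ring_1) \<Rightarrow> nat \<Rightarrow> nat set \<Rightarrow> 'a" where
  "pivot_sum t m S = (\<Sum>w\<in>arrangements (S - {m}).
     (- 1) ^ length w * t (m # w) * chen_sum t (S - insert m (set w)))"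

lemma card_remove_cycle:
  assumes "finite S" "m \<in> S" "w \<in> arrangements (S - {m})"
  shows "card S = Suc (length w) + card (S - insert m (set w))"
proof -
  have "m \<notin> set w" "distinct w" using assms(3) by (auto simp: arrangements_def)
  then have "card (insert m (set w)) = Suc (length w)"
    by (simp add: distinct_card)
  moreover have "insert m (set w) \<subseteq> S" using assms by (auto simp: arrangements_def)
  moreover have "card (insert m (set w)) \<le> card S" using calculation(2) assms(1) card_mono by blast
  ultimately show ?thesis using card_Diff_subset[of "insert m (set w)" S] by simp
qed

lemma chen_sum_Max:
  assumes "finite S" "S \<noteq> {}"
  shows "chen_sum t S = pivot_sum t (Max S) S"
proof -
  let ?m = "Max S" and ?A = "arrangements (S - {Max S})"
  let ?R = "\<lambda>w. S - insert (Max S) (set w)"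
  have "chen_sum t S = (\<Sum>(w, cs)\<in>(SIGMA w:?A. chen_forms (?R w)).
     (- 1) ^ (card S - length ((?m # w) # cs)) * prod_list (map t ((?m # w) # cs)))"
    unfolding chen_sum_def
    by (subst sum.reindex_bij_betw[OF chen_forms_rec[OF assms], symmetric])
      (simp add: case_prod_beta)
  also have "\<dots> = (\<Sum>w\<in>?A. \<Sum>cs\<in>chen_forms (?R w).
     (- 1) ^ (card S - length ((?m # w) # cs)) * prod_list (map t ((?m # w) # cs)))"
    by (subst sum.Sigma) (auto simp: finite_arrangements assms finite_chen_forms)
  also have "\<dots> = pivot_sum t ?m S"
    unfolding pivot_sum_def
  proof (rule sum.cong[OF refl])
    fix w assume w: "w \<in> ?A"
    have "card S - length ((?m # w) # cs) = length w + (card (?R w) - length cs)"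
      if "cs \<in> chen_forms (?R w)" for cs
      using card_remove_cycle[OF assms(1) _ w] length_le_card_if_chen_form[OF that] assms by simp
    then show "(\<Sum>cs\<in>chen_forms (?R w).
         (- 1) ^ (card S - length ((?m # w) # cs)) * prod_list (map t ((?m # w) # cs))) =
       (- 1) ^ length w * t (?m # w) * chen_sum t (?R w)"
      unfolding chen_sum_def sum_distrib_left
      by (intro sum.cong refl) (simp add: minus_one_power_iff mult.assoc)
  qed
  finally show ?thesis .
qed

text \<open>The permutation is the composition of the cyclic permutations given by the members of \<open>cs\<close>;
  as these are disjoint, each acts on its own entries as if alone.\<close>

lemma ex_permutes_if_chen_form:
  assumes "cs \<in> chen_forms S"
  shows "\<exists>p. p permutes S \<and> (\<forall>c\<in>set cs. map p c = rotate1 c)"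
proof -
  have "\<exists>p. p permutes set (concat cs) \<and> (\<forall>c\<in>set cs. map p c = rotate1 c)"
    if "distinct (concat cs)" for cs :: "nat list list"
    using that
  proof (induction cs)
    case Nil
    then show ?case by (auto intro: permutes_id)
  next
    case (Cons c cs)
    then obtain p where p: "p permutes set (concat cs)" "\<forall>c\<in>set cs. map p c = rotate1 c"
      by auto
    have disj: "set c \<inter> set (concat cs) = {}" and c: "distinct c" using Cons.prems by auto
    let ?q = "cycle_of_list c \<circ> p"
    have "?q permutes set (concat (c # cs))"
      using p(1) cycle_permutes[of c]
      by (intro permutes_compose) (auto elim: permutes_subset)
    moreover have "map ?q c = rotate1 c"
    proof -
      have "map p c = c" using permutes_not_in[OF p(1)] disj by (intro map_idI) blast
      then have "map ?q c = map (cycle_of_list c) c" by (metis map_map)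
      also have "\<dots> = rotate1 c" using cyclic_rotation[OF c, of 1] by simp
      finally show ?thesis .
    qed
    moreover have "map ?q d = rotate1 d" if "d \<in> set cs" for d
    proof -
      have "map ?q d = map (cycle_of_list c) (rotate1 d)" using p(2) that by (metis map_map)
      also have "\<dots> = rotate1 d"
        using disj that by (intro map_idI id_outside_supp) auto
      finally show ?thesis .
    qed
    ultimately show ?case by auto
  qed
  then show ?thesis using assms by (auto simp: chen_forms_def)
qed

text \<open>A permutation can be read off from any of its Chen forms, which list every index followed by its image.\<close>

lemma chen_cycles_bij_betw:
  "bij_betw (chen_cycles n) {p. p permutes {..<n}} (chen_forms {..<n})"
proof -
  have form: "is_chen_form n p (chen_cycles n p)" if "p permutes {..<n}" for p
    using is_chen_form_iff[OF that] by blast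
  have "p = q" if p: "p permutes {..<n}" and q: "q permutes {..<n}"
    and eq: "chen_cycles n p = chen_cycles n q" for p q
  proof
    fix x
    show "p x = q x"
    proof (cases "x < n")
      case True
      then obtain c where c: "c \<in> set (chen_cycles n p)" "x \<in> set c"
        using form[OF p] by (auto simp: is_chen_form_def)
      then have "map p c = map q c"
        using form[OF p] form[OF q] eq by (simp add: is_chen_form_def)
      then show ?thesis using c by auto
    qed (use permutes_not_in[OF p] permutes_not_in[OF q] in simp)
  qed
  moreover have "chen_cycles n p \<in> chen_forms {..<n}" if "p permutes {..<n}" for p
    using form[OF that] by (simp add: is_chen_form_def chen_forms_def)
  moreover have "\<exists>p. p permutes {..<n} \<and> cs = chen_cycles n p" if cs: "cs \<in> chen_forms {..<n}" for cs
  proof -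
    obtain p where p: "p permutes {..<n}" "\<forall>c\<in>set cs. map p c = rotate1 c"
      using ex_permutes_if_chen_form[OF cs] by blast
    then have "is_chen_form n p cs" using cs by (simp add: is_chen_form_def chen_forms_def)
    then show ?thesis using is_chen_form_iff p(1) by blast
  qed
  ultimately show ?thesis unfolding bij_betw_def inj_on_def by blast
qed

lemma Cdet_eq_chen_sum: "Cdet A = chen_sum (cycle_product A) {..<dim_row A}"
  unfolding Cdet_def chen_sum_def
  by (subst sum.reindex_bij_betw[OF chen_cycles_bij_betw, symmetric]) simp

section \<open>Commutative Chen sums\<close>

text \<open>Pairs of disjoint lists. They index both the pairs of cycles \<open>(i u)(j v)\<close> and the single cycles
  \<open>(i u j v)\<close>.\<close>

definition arrangement_pairs :: "'a set \<Rightarrow> ('a list \<times> 'a list) set" where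
  "arrangement_pairs S = {(u, v). u @ v \<in> arrangements S}"

lemma arrangement_pairs_Sigma:
  "arrangement_pairs S = (SIGMA u:arrangements S. arrangements (S - set u))"
  by (auto simp: arrangement_pairs_def arrangements_def)

text \<open>Expanding along the cycle of \<open>i\<close>, that cycle either contains \<open>j\<close>, and is then \<open>(i u j v)\<close>, or
  does not, and then one expands further along the cycle \<open>(j v)\<close> of \<open>j\<close>. A cycle \<open>(i u j v)\<close> has one
  more sign than the pair \<open>(i u)(j v)\<close>, which explains the difference on the right. The point
  of the formula is that its right-hand side is symmetric in \<open>i\<close> and \<open>j\<close> when \<open>t\<close> is invariant under
  rotation.\<close>

lemma pivot_sum_double:
  fixes t :: "nat list \<Rightarrow> 'a::comm_ring_1"
  assumes fin: "finite S" and ij: "i \<in> S" "j \<in> S" "i \<noteq> j"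
    and expand: "\<And>S'. S' \<subset> S \<Longrightarrow> j \<in> S' \<Longrightarrow> chen_sum t S' = pivot_sum t j S'"
  shows "pivot_sum t i S = (\<Sum>(u, v)\<in>arrangement_pairs (S - {i, j}).
    (- 1) ^ (length u + length v) * (t (i # u) * t (j # v) - t (i # u @ j # v)) *
    chen_sum t (S - insert i (insert j (set u \<union> set v))))"
proof -
  let ?Q = "arrangement_pairs (S - {i, j})"
  let ?R = "\<lambda>(u, v). chen_sum t (S - insert i (insert j (set u \<union> set v)))"
  let ?f = "\<lambda>w. (- 1) ^ length w * t (i # w) * chen_sum t (S - insert i (set w))"
  let ?W = "{w \<in> arrangements (S - {i}). j \<in> set w}"
  have finA: "finite (arrangements (S' :: nat set))" if "S' \<subseteq> S" for S'
    using finite_arrangements finite_subset fin that by blast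
  have split: "arrangements (S - {i}) = arrangements (S - {i, j}) \<union> ?W"
    by (auto simp: arrangements_def)
  have "pivot_sum t i S = sum ?f (arrangements (S - {i, j})) + sum ?f ?W"
    unfolding pivot_sum_def
    by (subst split, rule sum.union_disjoint)
      (simp_all add: finA Int_def arrangements_def[of "S - {i, j}", THEN eqset_imp_iff] conj_ac subset_Diff_insert)
  also have "sum ?f (arrangements (S - {i, j})) =
    (\<Sum>u\<in>arrangements (S - {i, j}). \<Sum>v\<in>arrangements (S - {i, j} - set u).
      (- 1) ^ (length u + length v) * (t (i # u) * t (j # v)) * ?R (u, v))"
  proof (rule sum.cong[OF refl])
    fix u assume u: "u \<in> arrangements (S - {i, j})"
    have "S - insert i (set u) \<subset> S" "j \<in> S - insert i (set u)"
      using u ij by (auto simp: arrangements_def)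
    note e = expand[OF this]
    have [simp]: "S - insert i (set u) - {j} = S - {i, j} - set u"
      "S - insert i (set u) - insert j (set v) = S - insert i (insert j (set u \<union> set v))" for v
      by auto
    show "?f u = (\<Sum>v\<in>arrangements (S - {i, j} - set u).
        (- 1) ^ (length u + length v) * (t (i # u) * t (j # v)) * ?R (u, v))"
      unfolding e pivot_sum_def sum_distrib_left
      by (intro sum.cong refl) (simp_all add: power_add mult_ac)
  qed
  also have "\<dots> = (\<Sum>(u, v)\<in>?Q. (- 1) ^ (length u + length v) * (t (i # u) * t (j # v)) * ?R (u, v))"
    unfolding arrangement_pairs_Sigma
    by (subst sum.Sigma) (auto intro!: finA)
  also have "sum ?f ?W =
    (\<Sum>(u, v)\<in>?Q. - ((- 1) ^ (length u + length v) * t (i # u @ j # v) * ?R (u, v)))"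
  proof -
    have "bij_betw (\<lambda>(u, v). u @ j # v) ?Q ?W"
    proof (rule bij_betw_imageI)
      show "inj_on (\<lambda>(u, v). u @ j # v) ?Q"
        by (auto simp: inj_on_def arrangement_pairs_def arrangements_def subset_Diff_insert
            append_Cons_eq_iff)
      show "(\<lambda>(u, v). u @ j # v) ` ?Q = ?W"
      proof (intro equalityI subsetI)
        fix w assume w: "w \<in> ?W"
        then obtain u v where "w = u @ j # v" by (auto dest: split_list)
        with w have "(u, v) \<in> ?Q"
          by (auto simp: arrangement_pairs_def arrangements_def)
        then show "w \<in> (\<lambda>(u, v). u @ j # v) ` ?Q" using \<open>w = u @ j # v\<close> by force
      qed (use ij in \<open>auto simp: arrangement_pairs_def arrangements_def\<close>)
    qed
    from sum.reindex_bij_betw[OF this, symmetric, of ?f]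
    show ?thesis by (simp add: case_prod_beta)
  qed
  finally show ?thesis
    by (simp add: sum.distrib[symmetric] case_prod_beta algebra_simps)
qed

text \<open>The Chen order amounts to an expansion along the largest index. The symmetry of the double
  expansion in its two indices transfers this to every other index.\<close>

theorem chen_sum_eq_pivot_sum:
  fixes t :: "nat list \<Rightarrow> 'a::comm_ring_1"
  assumes rot: "\<And>i u j v. t (i # u @ j # v) = t (j # v @ i # u)"
    and "finite S" "m \<in> S"
  shows "chen_sum t S = pivot_sum t m S"
  using assms(2,3)
proof (induction "card S" arbitrary: S m rule: less_induct)
  case less
  have expand: "chen_sum t S' = pivot_sum t j S'" if "S' \<subset> S" "j \<in> S'" for S' j
    using less that by (meson finite_subset psubset_card_mono psubset_imp_subset)
  show ?case
  proof (cases "m = Max S")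
    case True
    then show ?thesis using chen_sum_Max less.prems by blast
  next
    case False
    let ?M = "Max S"
    let ?g = "\<lambda>i j (u, v). (- 1) ^ (length u + length v) *
      (t (i # u) * t (j # v) - t (i # u @ j # v)) *
      chen_sum t (S - insert i (insert j (set u \<union> set v)))"
    have M: "?M \<in> S" using less.prems by (intro Max_in) auto
    have "chen_sum t S = pivot_sum t ?M S"
      using chen_sum_Max less.prems by blast
    also have "\<dots> = sum (?g ?M m) (arrangement_pairs (S - {?M, m}))"
      using False by (intro pivot_sum_double less.prems M expand) auto
    \<comment> \<open>Interchanging the two lists rotates the joint cycle.\<close>
    also have "\<dots> = sum (?g m ?M) (arrangement_pairs (S - {m, ?M}))"
    proof (rule sum.reindex_bij_witness[of _ prod.swap prod.swap])
      fix q assume "q \<in> arrangement_pairs (S - {?M, m})"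
      then show "prod.swap q \<in> arrangement_pairs (S - {m, ?M})"
        by (auto simp: arrangement_pairs_def arrangements_def)
      obtain u v where q: "q = (u, v)" by fastforce
      have "insert m (insert ?M (set v \<union> set u)) = insert ?M (insert m (set u \<union> set v))" by auto
      then show "?g m ?M (prod.swap q) = ?g ?M m q"
        unfolding q by (simp add: rot[of m v ?M u] add.commute mult.commute)
    qed (auto simp: arrangement_pairs_def arrangements_def)
    also have "\<dots> = pivot_sum t m S"
      using False by (intro pivot_sum_double[symmetric] less.prems M expand) auto
    finally show ?thesis .
  qed
qed

lemma chen_sum_cong:
  assumes "\<And>w. w \<noteq> [] \<Longrightarrow> set w \<subseteq> S \<Longrightarrow> t w = t' w"
  shows "chen_sum t S = chen_sum t' S"
proof -
  have "map t cs = map t' cs" if "cs \<in> chen_forms S" for cs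
    using that assms by (intro map_cong refl) (auto simp: chen_forms_def)
  then show ?thesis unfolding chen_sum_def by (intro sum.cong refl) metis
qed

text \<open>An injective renaming need not preserve the largest index; it matters that any index can
  serve as the pivot.\<close>

theorem chen_sum_relabel:
  fixes t :: "nat list \<Rightarrow> 'a::comm_ring_1"
  assumes rot: "\<And>i u j v. t (i # u @ j # v) = t (j # v @ i # u)"
    and "finite S" "inj_on f S"
  shows "chen_sum (\<lambda>w. t (map f w)) S = chen_sum t (f ` S)"
  using assms(2,3)
proof (induction "card S" arbitrary: S rule: less_induct)
  case less
  show ?case
  proof (cases "S = {}")
    case False
    then obtain m where m: "m \<in> S" by blast
    have "chen_sum (\<lambda>w. t (map f w)) S = pivot_sum (\<lambda>w. t (map f w)) m S"
      by (intro chen_sum_eq_pivot_sum less.prems m) (simp add: rot)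
    also have "\<dots> = pivot_sum t (f m) (f ` S)"
      unfolding pivot_sum_def
    proof (rule sum.reindex_bij_witness[of _ "map (inv_into S f)" "map f"])
      fix w assume w: "w \<in> arrangements (S - {m})"
      then have wS: "set w \<subseteq> S" "distinct w" "m \<notin> set w" by (auto simp: arrangements_def)
      have inj: "inj_on f (set w)" using less.prems(2) wS(1) inj_on_subset by blast
      show "map (inv_into S f) (map f w) = w"
        using less.prems(2) wS(1) unfolding map_map by (intro map_idI) auto
      have nm: "f m \<notin> f ` set w" using less.prems(2) wS m by (auto dest: inj_onD)
      then have "f ` set w \<subseteq> f ` S - {f m}" using wS by blast
      then show "map f w \<in> arrangements (f ` S - {f m})"
        using wS inj by (simp add: arrangements_def distinct_map)
      have "S - insert m (set w) \<subset> S" using m by auto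
      then have "chen_sum (\<lambda>w. t (map f w)) (S - insert m (set w)) =
          chen_sum t (f ` (S - insert m (set w)))"
        using less.prems
        by (intro less.hyps psubset_card_mono) (auto intro: inj_on_subset)
      also have "f ` (S - insert m (set w)) = f ` S - insert (f m) (set (map f w))"
        using inj_on_image_set_diff[OF less.prems(2), of S "insert m (set w)"] wS m by auto
      finally show "(- 1) ^ length (map f w) * t (f m # map f w) *
          chen_sum t (f ` S - insert (f m) (set (map f w))) =
        (- 1) ^ length w * t (map f (m # w)) *
          chen_sum (\<lambda>w. t (map f w)) (S - insert m (set w))"
        by simp
    next
      fix w assume w: "w \<in> arrangements (f ` S - {f m})"
      then have wS: "set w \<subseteq> f ` S" "distinct w" "f m \<notin> set w" by (auto simp: arrangements_def)
      show "map f (map (inv_into S f) w) = w"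
        using wS(1) unfolding map_map by (intro map_idI) (auto intro: f_inv_into_f)
      have "inj_on (inv_into S f) (set w)" using wS(1) inj_on_inv_into by blast
      moreover have "inv_into S f x \<noteq> m" if "x \<in> set w" for x
        using that wS f_inv_into_f[of x f S] by auto
      ultimately show "map (inv_into S f) w \<in> arrangements (S - {m})"
        using wS by (auto simp: arrangements_def distinct_map inv_into_into)
    qed
    also have "\<dots> = chen_sum t (f ` S)"
      using less.prems m by (intro chen_sum_eq_pivot_sum[symmetric] rot) auto
    finally show ?thesis .
  qed simp
qed

text \<open>In the double expansion the term of \<open>(u, v)\<close> cancels against that of \<open>(u, rev v)\<close>. The result is
  stated for the doubled sum because in the ring of values \<open>2\<close> need not be cancellable.\<close>

theorem double_chen_sum_eq_0:
  fixes t :: "nat list \<Rightarrow> 'a::comm_ring_1"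
  assumes rot: "\<And>i u j v. t (i # u @ j # v) = t (j # v @ i # u)"
    and fin: "finite S" and ij: "i \<in> S" "j \<in> S" "i \<noteq> j"
    and rev: "\<And>u v. set u \<subseteq> S \<Longrightarrow> set v \<subseteq> S \<Longrightarrow>
      t (i # u @ j # v) + t (i # u @ j # rev v) = t (i # u) * t (j # v) + t (i # u) * t (j # rev v)"
  shows "chen_sum t S + chen_sum t S = 0"
proof -
  let ?g = "\<lambda>(u, v). (- 1) ^ (length u + length v) *
    (t (i # u) * t (j # v) - t (i # u @ j # v)) *
    chen_sum t (S - insert i (insert j (set u \<union> set v)))"
  let ?r = "\<lambda>(u, v). (u, rev v)"
  let ?Q = "arrangement_pairs (S - {i, j})"
  have pivot: "chen_sum t S' = pivot_sum t m S'" if "S' \<subseteq> S" "m \<in> S'" for S' m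
    by (rule chen_sum_eq_pivot_sum) (use rot fin that finite_subset in auto)
  have e: "chen_sum t S = sum ?g ?Q"
    unfolding pivot[OF order.refl ij(1)]
    by (rule pivot_sum_double) (use fin ij pivot in auto)
  \<comment> \<open>Reversing the second list permutes the index set and keeps the sign and the remaining indices.\<close>
  have "sum ?g ?Q = (\<Sum>q\<in>?Q. ?g (?r q))"
    by (rule sum.reindex_bij_witness[of _ ?r ?r])
      (auto simp: arrangement_pairs_def arrangements_def)
  then have "chen_sum t S + chen_sum t S = (\<Sum>q\<in>?Q. ?g q + ?g (?r q))"
    by (simp add: e sum.distrib)
  also have "\<dots> = 0"
  proof (rule sum.neutral, rule ballI)
    fix q assume "q \<in> ?Q"
    then obtain u v where q: "q = (u, v)" and "set u \<subseteq> S" "set v \<subseteq> S"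
      by (auto simp: arrangement_pairs_def arrangements_def subset_Diff_insert)
    from rev[OF this(2,3)]
    have "(t (i # u) * t (j # v) - t (i # u @ j # v)) +
      (t (i # u) * t (j # rev v) - t (i # u @ j # rev v)) = 0" (is "?x + ?y = 0")
      by (simp add: algebra_simps)
    moreover have "?g q + ?g (?r q) = (- 1) ^ (length u + length v) * (?x + ?y) *
      chen_sum t (S - insert i (insert j (set u \<union> set v)))"
      unfolding q by (simp add: algebra_simps)
    ultimately show "?g q + ?g (?r q) = 0" by simp
  qed
  finally show ?thesis .
qed

section \<open>Dual numbers inside the dual quaternions\<close>

text \<open>The centre of the dual quaternions consists of the dual numbers. Real parts are taken in a separate
  type because the commutative Chen sums need values in a commutative ring.\<close>

datatype dual_number = Dual (dn_std: real) (dn_dual: real)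

instantiation dual_number :: comm_ring_1
begin
definition "0 = Dual 0 0"
definition "1 = Dual 1 0"
definition "x + y = Dual (dn_std x + dn_std y) (dn_dual x + dn_dual y)"
definition "- x = Dual (- dn_std x) (- dn_dual x)"
definition "x - y = Dual (dn_std x - dn_std y) (dn_dual x - dn_dual y)"
definition "x * y = Dual (dn_std x * dn_std y) (dn_std x * dn_dual y + dn_dual x * dn_std y)"
instance
  by standard
    (simp_all add: zero_dual_number_def one_dual_number_def plus_dual_number_def
      uminus_dual_number_def minus_dual_number_def times_dual_number_def
      dual_number.expand algebra_simps)
end

lemmas dual_number_ops = zero_dual_number_def one_dual_number_def plus_dual_number_def
  uminus_dual_number_def minus_dual_number_def times_dual_number_def

lemmas dquat_ops = zero_quat_def one_quat_def plus_quat_def uminus_quat_def minus_quat_def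
  times_quat_def zero_dquat_def one_dquat_def plus_dquat_def uminus_dquat_def minus_dquat_def
  times_dquat_def

lemma of_nat_dual_number: "of_nat k = Dual (real k) 0"
  by (induction k) (simp_all add: dual_number_ops)

text \<open>Dual numbers have zero divisors, so cancellation of positive integers is not a consequence of
  characteristic zero alone.\<close>

lemma of_nat_mult_left_cancel_dual_number:
  fixes x y :: dual_number
  assumes "of_nat k * x = of_nat k * y" "0 < k"
  shows "x = y"
  using assms by (simp add: of_nat_dual_number times_dual_number_def dual_number.expand)

definition of_dual :: "dual_number \<Rightarrow> dquat" where
  "of_dual d = DQuat (Quat (dn_std d) 0 0 0) (Quat (dn_dual d) 0 0 0)"

definition re_dual :: "dquat \<Rightarrow> dual_number" where
  "re_dual q = Dual (qRe (dq_std q)) (qRe (dq_dual q))"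

lemma of_dual_0 [simp]: "of_dual 0 = 0"
  and of_dual_1 [simp]: "of_dual 1 = 1"
  and of_dual_add: "of_dual (x + y) = of_dual x + of_dual y"
  and of_dual_minus: "of_dual (- x) = - of_dual x"
  and of_dual_mult: "of_dual (x * y) = of_dual x * of_dual y"
  by (simp_all add: of_dual_def dual_number_ops dquat_ops)

lemma of_dual_sum: "of_dual (sum f I) = (\<Sum>x\<in>I. of_dual (f x))"
  by (induction I rule: infinite_finite_induct) (simp_all add: of_dual_add)

lemma of_dual_minus_one_power: "of_dual ((- 1) ^ k) = (- 1) ^ k"
  by (induction k) (simp_all add: of_dual_mult of_dual_minus)

lemma re_dual_0 [simp]: "re_dual 0 = 0"
  and re_dual_add: "re_dual (x + y) = re_dual x + re_dual y"
  and re_dual_diff: "re_dual (x - y) = re_dual x - re_dual y"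
  by (simp_all add: re_dual_def dual_number_ops dquat_ops)

lemma re_dual_sum: "re_dual (sum f I) = (\<Sum>x\<in>I. re_dual (f x))"
  by (induction I rule: infinite_finite_induct) (simp_all add: re_dual_add)

lemma re_dual_mult_commute: "re_dual (x * y) = re_dual (y * x)"
  by (simp add: re_dual_def dquat_ops algebra_simps)

lemma dqcnj_add: "dqcnj (x + y) = dqcnj x + dqcnj y"
  by (simp add: dqcnj_def qcnj_def dquat_ops)
lemma dqcnj_0 [simp]: "dqcnj 0 = 0"
  by (simp add: dqcnj_def qcnj_def dquat_ops)
lemma dqcnj_1 [simp]: "dqcnj 1 = 1"
  by (simp add: dqcnj_def qcnj_def dquat_ops)
lemma dqcnj_diff: "dqcnj (x - y) = dqcnj x - dqcnj y"
  by (simp add: dqcnj_def qcnj_def dquat_ops)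
lemma dqcnj_mult: "dqcnj (x * y) = dqcnj y * dqcnj x"
  by (simp add: dqcnj_def qcnj_def dquat_ops algebra_simps)
lemma dqcnj_dqcnj [simp]: "dqcnj (dqcnj x) = x"
  by (simp add: dqcnj_def qcnj_def)
lemma dqcnj_sum: "dqcnj (sum f I) = (\<Sum>x\<in>I. dqcnj (f x))"
  by (induction I rule: infinite_finite_induct) (simp_all add: dqcnj_add)

lemma add_dqcnj_eq: "x + dqcnj x = of_dual (re_dual x) + of_dual (re_dual x)"
  by (simp add: dqcnj_def qcnj_def dquat_ops re_dual_def of_dual_def)

lemma re_dual_mult_of_dual: "re_dual (x * of_dual d) = re_dual x * d"
  by (simp add: dquat_ops dual_number_ops re_dual_def of_dual_def)

lemma double_cancel_dquat: "x + x = y + y \<Longrightarrow> x = (y::dquat)"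
  by (simp add: dquat_ops dquat.expand quat.expand)

text \<open>The identity behind the vanishing of determinants with a repeated index.\<close>

lemma re_dual_mult_add_dqcnj:
  "re_dual (x * y) + re_dual (x * dqcnj y) = re_dual x * re_dual y + re_dual x * re_dual y"
  by (simp add: re_dual_add[symmetric] distrib_left[symmetric] add_dqcnj_eq)
    (simp add: distrib_left re_dual_add re_dual_mult_of_dual)

lemma re_dual_dqcnj [simp]: "re_dual (dqcnj x) = re_dual x"
  by (simp add: re_dual_def dqcnj_def qcnj_def)

section \<open>Cycle products of Hermitian matrices\<close>

text \<open>Unlike cycle products, products along open paths split at an intermediate vertex, and their sums over \<open>w\<close> are entries of matrix powers.\<close>

fun path_product :: "'a::ring_1 mat \<Rightarrow> nat \<Rightarrow> nat list \<Rightarrow> nat \<Rightarrow> 'a" where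
  "path_product A i [] j = A $$ (i, j)"
| "path_product A i (k # w) j = A $$ (i, k) * path_product A k w j"

lemma cycle_product_Cons: "cycle_product A (i # w) = path_product A i w i"
proof -
  have "prod_list (map2 (\<lambda>i j. A $$ (i, j)) (i # w) (w @ [j])) = path_product A i w j" for j
    by (induction w arbitrary: i) auto
  then show ?thesis by (simp add: cycle_product_def)
qed

lemma path_product_append:
  "path_product A i (u @ k # v) j = path_product A i u k * path_product A k v j"
  by (induction u arbitrary: i) (simp_all add: mult.assoc)

lemma dq_hermitian_index:
  assumes "dq_hermitian A" "A \<in> carrier_mat n n" "i < n" "j < n"
  shows "A $$ (i, j) = dqcnj (A $$ (j, i))"
proof -
  have "A $$ (i, j) = dq_adjoint A $$ (i, j)" using assms(1) by (simp add: dq_hermitian_def)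
  then show ?thesis using assms(2-) by (simp add: dq_adjoint_def)
qed

lemma path_product_rev:
  assumes "dq_hermitian A" "A \<in> carrier_mat n n" "i < n" "j < n" "set w \<subseteq> {..<n}"
  shows "path_product A i (rev w) j = dqcnj (path_product A j w i)"
  using assms(4,5)
proof (induction w arbitrary: j)
  case Nil
  then show ?case using dq_hermitian_index[OF assms(1,2), of i j] assms(3) by simp
next
  case (Cons k w)
  then show ?case
    using dq_hermitian_index[OF assms(1,2), of k j] by (simp add: path_product_append dqcnj_mult)
qed

definition re_cycle :: "dquat mat \<Rightarrow> nat list \<Rightarrow> dual_number" where
  "re_cycle A w = re_dual (cycle_product A w)"

lemma re_cycle_rotate: "re_cycle A (i # u @ j # v) = re_cycle A (j # v @ i # u)"
  by (simp add: re_cycle_def cycle_product_Cons path_product_append re_dual_mult_commute)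

text \<open>By induction the factors after the first cycle sum to a central element. Hence the terms
  of the first cycle and of its reverse, which have conjugate cycle products, combine to a real part.\<close>

theorem chen_sum_cycle_product_hermitian:
  assumes herm: "dq_hermitian A" "A \<in> carrier_mat n n" and "S \<subseteq> {..<n}"
  shows "chen_sum (cycle_product A) S = of_dual (chen_sum (re_cycle A) S)"
  using assms(3)
proof (induction "card S" arbitrary: S rule: less_induct)
  case less
  have fin: "finite S" using less.prems finite_subset by blast
  show ?case
  proof (cases "S = {}")
    case False
    define m where "m = Max S"
    have m: "m \<in> S" using fin False by (simp add: m_def)
    then have "m < n" using less.prems by auto
    let ?A = "arrangements (S - {m})"
    let ?G = "\<lambda>w. of_dual (chen_sum (re_cycle A) (S - insert m (set w)))"
    let ?h = "\<lambda>w. (- 1) ^ length w * cycle_product A (m # w) * ?G w"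
    have IH: "chen_sum (cycle_product A) (S - insert m (set w)) = ?G w" for w
      using less.prems fin m by (intro less.hyps psubset_card_mono) auto
    have e: "chen_sum (cycle_product A) S = sum ?h ?A"
      unfolding chen_sum_Max[OF fin False] m_def[symmetric] pivot_sum_def IH ..
    \<comment> \<open>Reversing \<open>w\<close> reverses the cycle \<open>m # w\<close> up to rotation.\<close>
    have "sum ?h ?A = (\<Sum>w\<in>?A. ?h (rev w))"
      by (rule sum.reindex_bij_witness[of _ rev rev]) (auto simp: arrangements_def)
    then have "sum ?h ?A + sum ?h ?A = (\<Sum>w\<in>?A. ?h w + ?h (rev w))"
      by (simp add: sum.distrib)
    also have "\<dots> = (\<Sum>w\<in>?A. of_dual ((- 1) ^ length w * re_cycle A (m # w) *
        chen_sum (re_cycle A) (S - insert m (set w)))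
      + of_dual ((- 1) ^ length w * re_cycle A (m # w) *
        chen_sum (re_cycle A) (S - insert m (set w))))"
    proof (rule sum.cong[OF refl])
      fix w assume "w \<in> ?A"
      then have "set w \<subseteq> {..<n}" using less.prems by (auto simp: arrangements_def)
      from path_product_rev[OF herm \<open>m < n\<close> \<open>m < n\<close> this]
      have "?h w + ?h (rev w) = (- 1) ^ length w *
          (path_product A m w m + dqcnj (path_product A m w m)) * ?G w"
        by (simp add: cycle_product_Cons distrib_left distrib_right)
      then show "?h w + ?h (rev w) = of_dual ((- 1) ^ length w * re_cycle A (m # w) *
          chen_sum (re_cycle A) (S - insert m (set w)))
        + of_dual ((- 1) ^ length w * re_cycle A (m # w) *
          chen_sum (re_cycle A) (S - insert m (set w)))"
        by (simp add: add_dqcnj_eq re_cycle_def cycle_product_Cons of_dual_mult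
            of_dual_minus_one_power distrib_left distrib_right)
    qed
    also have "\<dots> = of_dual (pivot_sum (re_cycle A) m S) + of_dual (pivot_sum (re_cycle A) m S)"
      by (simp add: pivot_sum_def of_dual_sum sum.distrib)
    finally have "sum ?h ?A = of_dual (pivot_sum (re_cycle A) m S)"
      by (rule double_cancel_dquat)
    then show ?thesis unfolding e by (simp add: chen_sum_Max[OF fin False] flip: m_def)
  qed simp
qed

text \<open>When \<open>f i = f j\<close>, the image of the cycle \<open>(i u j v)\<close> is the concatenation of two closed paths at
  the same vertex, and reversing \<open>v\<close> conjugates the second one.\<close>

theorem chen_sum_re_cycle_not_inj:
  assumes herm: "dq_hermitian A" "A \<in> carrier_mat n n"
    and "finite S" "f ` S \<subseteq> {..<n}" "\<not> inj_on f S"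
  shows "chen_sum (\<lambda>w. re_cycle A (map f w)) S = 0"
proof -
  obtain i j where ij: "i \<in> S" "j \<in> S" "i \<noteq> j" "f i = f j"
    using assms(5) by (auto simp: inj_on_def)
  let ?t = "\<lambda>w. re_cycle A (map f w)"
  have "chen_sum ?t S + chen_sum ?t S = 0"
  proof (rule double_chen_sum_eq_0[OF _ assms(3) ij(1-3)])
    show "?t (i # u @ j # v) = ?t (j # v @ i # u)" for i u j v by (simp add: re_cycle_rotate)
    fix u v assume uv: "set u \<subseteq> S" "set v \<subseteq> S"
    have "path_product A (f j) (rev (map f v)) (f j) = dqcnj (path_product A (f j) (map f v) (f j))"
      using assms ij uv by (intro path_product_rev[OF herm]) auto
    then show "?t (i # u @ j # v) + ?t (i # u @ j # rev v) =
      ?t (i # u) * ?t (j # v) + ?t (i # u) * ?t (j # rev v)"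
      by (simp add: re_cycle_def cycle_product_Cons path_product_append ij(4) rev_map
          re_dual_mult_add_dqcnj)
  qed
  then have "of_nat 2 * chen_sum ?t S = of_nat 2 * 0" by (simp add: algebra_simps)
  then show ?thesis by (rule of_nat_mult_left_cancel_dual_number) simp
qed

section \<open>Summing over all index maps\<close>

definition re_trace :: "dquat mat \<Rightarrow> dual_number" where
  "re_trace A = (\<Sum>i<dim_row A. re_dual (A $$ (i, i)))"

lemma re_trace_diff:
  assumes "A \<in> carrier_mat n n" "B \<in> carrier_mat n n"
  shows "re_trace (A - B) = re_trace A - re_trace B"
  using assms by (simp add: re_trace_def re_dual_diff sum_subtractf)

lemma re_trace_mult_commute:
  assumes "A \<in> carrier_mat n m" "B \<in> carrier_mat m n"
  shows "re_trace (A * B) = re_trace (B * A)"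
proof -
  have "re_trace (A * B) = (\<Sum>i<n. \<Sum>k<m. re_dual (A $$ (i, k) * B $$ (k, i)))"
    using assms by (simp add: re_trace_def scalar_prod_def re_dual_sum atLeast0LessThan)
  also have "\<dots> = (\<Sum>k<m. \<Sum>i<n. re_dual (B $$ (k, i) * A $$ (i, k)))"
    by (subst sum.swap) (simp add: re_dual_mult_commute)
  also have "\<dots> = re_trace (B * A)"
    using assms by (simp add: re_trace_def scalar_prod_def re_dual_sum atLeast0LessThan)
  finally show ?thesis .
qed

lemma pow_mat_Suc_left:
  fixes A :: "'a::semiring_1 mat"
  assumes A: "A \<in> carrier_mat n n"
  shows "A ^\<^sub>m Suc k = A * A ^\<^sub>m k"
proof (induction k)
  case 0
  then show ?case using A by auto
next
  case (Suc k)
  have "A ^\<^sub>m Suc (Suc k) = (A * A ^\<^sub>m k) * A" using Suc by simp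
  also have "\<dots> = A * (A ^\<^sub>m k * A)" using A pow_carrier_mat[OF A] by (intro assoc_mult_mat)
  finally show ?case by simp
qed

lemma sum_path_product_eq_pow_mat:
  fixes A :: "'a::ring_1 mat"
  assumes A: "A \<in> carrier_mat n n" and "i < n" "j < n"
  shows "(\<Sum>w | set w \<subseteq> {..<n} \<and> length w = k. path_product A i w j) = (A ^\<^sub>m Suc k) $$ (i, j)"
  using assms(2)
proof (induction k arbitrary: i)
  case 0
  have "{w. set w \<subseteq> {..<n} \<and> length w = 0} = {[]}" by auto
  then show ?case using A by simp
next
  case (Suc k)
  let ?L = "{w. set w \<subseteq> {..<n} \<and> length w = k}"
  have "(\<Sum>w | set w \<subseteq> {..<n} \<and> length w = Suc k. path_product A i w j) =
      (\<Sum>(w, a)\<in>?L \<times> {..<n}. path_product A i (a # w) j)"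
    unfolding lists_length_Suc_eq
    by (subst sum.reindex) (auto simp: inj_on_def case_prod_beta)
  also have "\<dots> = (\<Sum>a<n. A $$ (i, a) * (\<Sum>w\<in>?L. path_product A a w j))"
    by (subst sum.cartesian_product[symmetric], subst sum.swap) (simp add: sum_distrib_left)
  also have "\<dots> = (\<Sum>a<n. A $$ (i, a) * (A ^\<^sub>m Suc k) $$ (a, j))"
    using Suc.IH by simp
  also have "\<dots> = (A * A ^\<^sub>m Suc k) $$ (i, j)"
    using A pow_carrier_mat[OF A, of "Suc k"] Suc.prems assms(3)
    by (simp add: scalar_prod_def atLeast0LessThan del: pow_mat.simps)
  finally show ?case using pow_mat_Suc_left[OF A, of "Suc k"] by simp
qed

lemma sum_re_cycle_eq_re_trace:
  assumes A: "A \<in> carrier_mat n n"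
  shows "(\<Sum>w | set w \<subseteq> {..<n} \<and> length w = Suc k. re_cycle A w) = re_trace (A ^\<^sub>m Suc k)"
proof -
  let ?L = "{w. set w \<subseteq> {..<n} \<and> length w = k}"
  have "(\<Sum>w | set w \<subseteq> {..<n} \<and> length w = Suc k. re_cycle A w) =
      (\<Sum>(w, a)\<in>?L \<times> {..<n}. re_cycle A (a # w))"
    unfolding lists_length_Suc_eq
    by (subst sum.reindex) (auto simp: inj_on_def case_prod_beta)
  also have "\<dots> = (\<Sum>a<n. re_dual (\<Sum>w\<in>?L. path_product A a w a))"
    by (subst sum.cartesian_product[symmetric], subst sum.swap)
      (simp add: re_dual_sum re_cycle_def cycle_product_Cons)
  also have "\<dots> = re_trace (A ^\<^sub>m Suc k)"
    using A sum_path_product_eq_pow_mat[OF A] pow_carrier_mat[OF A, of "Suc k"]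
    by (simp add: re_trace_def del: pow_mat.simps)
  finally show ?thesis .
qed

text \<open>A map on a disjoint union is a pair of maps, so sums over maps factor along the cycles.\<close>

lemma sum_PiE_Un_disjoint:
  assumes "C \<inter> R = {}"
  shows "(\<Sum>f\<in>(C \<union> R) \<rightarrow>\<^sub>E X. F f) =
    (\<Sum>g\<in>C \<rightarrow>\<^sub>E X. \<Sum>h\<in>R \<rightarrow>\<^sub>E X. F (\<lambda>x. if x \<in> C then g x else h x))"
  unfolding sum.cartesian_product
  by (rule sum.reindex_bij_witness[of _ "\<lambda>(g, h) x. if x \<in> C then g x else h x"
        "\<lambda>f. (restrict f C, restrict f R)"])
    (use assms in \<open>auto simp: PiE_iff extensional_def fun_eq_iff restrict_def intro!: arg_cong[of _ _ F]\<close>)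

lemma bij_betw_map_PiE_lists:
  assumes "distinct c"
  shows "bij_betw (\<lambda>g. map g c) (set c \<rightarrow>\<^sub>E X) {w. set w \<subseteq> X \<and> length w = length c}"
proof (rule bij_betw_imageI)
  show "inj_on (\<lambda>g. map g c) (set c \<rightarrow>\<^sub>E X)"
    by (rule inj_onI) (auto intro: PiE_ext)
  have "\<exists>g\<in>set c \<rightarrow>\<^sub>E X. w = map g c" if w: "set w \<subseteq> X" "length w = length c" for w
  proof -
    let ?g = "restrict (\<lambda>x. the (map_of (zip c w) x)) (set c)"
    have "map ?g c = w"
      by (rule nth_equalityI) (use w assms in \<open>auto simp: map_of_zip_nth\<close>)
    moreover have "?g x \<in> X" if "x \<in> set c" for x
      using w calculation that by (metis image_eqI list.set_map subsetD)
    then have "?g \<in> set c \<rightarrow>\<^sub>E X" by (intro PiE_I) auto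
    ultimately show ?thesis by metis
  qed
  then show "(\<lambda>g. map g c) ` (set c \<rightarrow>\<^sub>E X) = {w. set w \<subseteq> X \<and> length w = length c}"
    by (auto simp: image_iff PiE_iff)
qed

text \<open>Admitting maps \<open>f\<close> that are not injective frees the indices, and this is what makes traces appear.
  Maps are taken extensional so that only their values on \<open>S\<close> count.\<close>

definition total_chen_sum :: "dquat mat \<Rightarrow> nat set \<Rightarrow> dual_number" where
  "total_chen_sum A S =
    (\<Sum>f\<in>S \<rightarrow>\<^sub>E {..<dim_row A}. chen_sum (\<lambda>w. re_cycle A (map f w)) S)"

text \<open>The values of \<open>f\<close> on the pivot cycle and on the other indices vary independently. The
  former run through all closed paths of the given length, and the products along these sum to a
  trace.\<close>

lemma total_chen_sum_rec:
  assumes A: "A \<in> carrier_mat n n" and S: "finite S" "m \<in> S"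
  shows "total_chen_sum A S = (\<Sum>w\<in>arrangements (S - {m}).
    (- 1) ^ length w * re_trace (A ^\<^sub>m Suc (length w)) * total_chen_sum A (S - insert m (set w)))"
proof -
  let ?X = "{..<n}" and ?R = "\<lambda>w. S - insert m (set w)"
  let ?t = "\<lambda>f w. re_cycle A (map f w)"
  have "total_chen_sum A S = (\<Sum>f\<in>S \<rightarrow>\<^sub>E ?X. pivot_sum (?t f) m S)"
    unfolding total_chen_sum_def using A
    by (intro sum.cong chen_sum_eq_pivot_sum S) (auto simp: re_cycle_rotate)
  also have "\<dots> = (\<Sum>w\<in>arrangements (S - {m}). \<Sum>f\<in>S \<rightarrow>\<^sub>E ?X.
      (- 1) ^ length w * (?t f (m # w) * chen_sum (?t f) (?R w)))"
    unfolding pivot_sum_def by (subst sum.swap) (simp add: mult.assoc)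
  also have "\<dots> = (\<Sum>w\<in>arrangements (S - {m}).
    (- 1) ^ length w * re_trace (A ^\<^sub>m Suc (length w)) * total_chen_sum A (?R w))"
  proof (rule sum.cong[OF refl])
    fix w assume w: "w \<in> arrangements (S - {m})"
    let ?C = "insert m (set w)"
    have dist: "distinct (m # w)" and CR: "S = ?C \<union> ?R w"
      using w S by (auto simp: arrangements_def)
    have "(\<Sum>f\<in>S \<rightarrow>\<^sub>E ?X. ?t f (m # w) * chen_sum (?t f) (?R w)) =
      (\<Sum>f\<in>(?C \<union> ?R w) \<rightarrow>\<^sub>E ?X. ?t f (m # w) * chen_sum (?t f) (?R w))"
      using CR by simp
    also have "\<dots> = (\<Sum>g\<in>?C \<rightarrow>\<^sub>E ?X. \<Sum>h\<in>?R w \<rightarrow>\<^sub>E ?X. ?t g (m # w) * chen_sum (?t h) (?R w))"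
    proof (subst sum_PiE_Un_disjoint, blast, intro sum.cong refl arg_cong2[of _ _ _ _ "(*)"])
      fix g h :: "nat \<Rightarrow> nat"
      let ?f = "\<lambda>x. if x \<in> ?C then g x else h x"
      show "?t ?f (m # w) = ?t g (m # w)" by (intro arg_cong[of _ _ "re_cycle A"]) simp
      show "chen_sum (?t ?f) (?R w) = chen_sum (?t h) (?R w)"
        by (intro chen_sum_cong arg_cong[of _ _ "re_cycle A"]) auto
    qed
    also have "\<dots> = (\<Sum>g\<in>?C \<rightarrow>\<^sub>E ?X. ?t g (m # w)) * total_chen_sum A (?R w)"
      using A by (simp add: total_chen_sum_def sum_product)
    also have "(\<Sum>g\<in>?C \<rightarrow>\<^sub>E ?X. ?t g (m # w)) = re_trace (A ^\<^sub>m Suc (length w))"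
      using sum.reindex_bij_betw[OF bij_betw_map_PiE_lists[OF dist, of ?X], of "re_cycle A"]
        sum_re_cycle_eq_re_trace[OF A, of "length w"] by simp
    finally show "(\<Sum>f\<in>S \<rightarrow>\<^sub>E ?X. (- 1) ^ length w * (?t f (m # w) * chen_sum (?t f) (?R w))) =
        (- 1) ^ length w * re_trace (A ^\<^sub>m Suc (length w)) * total_chen_sum A (?R w)"
      by (simp add: mult.assoc flip: sum_distrib_left)
  qed
  finally show ?thesis .
qed

lemma total_chen_sum_eq_if_re_trace_eq:
  assumes "A \<in> carrier_mat n n" "B \<in> carrier_mat n n"
    and tr: "\<And>k. re_trace (A ^\<^sub>m k) = re_trace (B ^\<^sub>m k)" and "finite S"
  shows "total_chen_sum A S = total_chen_sum B S"
  using assms(4)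
proof (induction "card S" arbitrary: S rule: less_induct)
  case less
  show ?case
  proof (cases "S = {}")
    case True
    then show ?thesis by (simp add: total_chen_sum_def)
  next
    case False
    then obtain m where m: "m \<in> S" by blast
    have "total_chen_sum A (S - insert m (set w)) = total_chen_sum B (S - insert m (set w))" for w
      using less.prems m by (intro less.hyps psubset_card_mono) auto
    then show ?thesis
      unfolding total_chen_sum_rec[OF assms(1) less.prems m] total_chen_sum_rec[OF assms(2) less.prems m]
      by (simp only: tr)
  qed
qed

text \<open>Maps that are not injective contribute nothing, and each injective one, being a permutation of
  the indices, contributes the determinant itself.\<close>

lemma total_chen_sum_hermitian:
  assumes "dq_hermitian A" and A: "A \<in> carrier_mat n n"
  shows "total_chen_sum A {..<n} =
    of_nat (card {f \<in> {..<n} \<rightarrow>\<^sub>E {..<n}. inj_on f {..<n}}) * chen_sum (re_cycle A) {..<n}"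
proof -
  let ?I = "{f \<in> {..<n} \<rightarrow>\<^sub>E {..<n}. inj_on f {..<n}}"
  have "total_chen_sum A {..<n} =
      (\<Sum>f\<in>{..<n} \<rightarrow>\<^sub>E {..<n}. if inj_on f {..<n} then chen_sum (re_cycle A) {..<n} else 0)"
    unfolding total_chen_sum_def using A
  proof (intro sum.cong)
    fix f assume f: "f \<in> {..<n} \<rightarrow>\<^sub>E {..<n}"
    show "chen_sum (\<lambda>w. re_cycle A (map f w)) {..<n} =
        (if inj_on f {..<n} then chen_sum (re_cycle A) {..<n} else 0)"
    proof (cases "inj_on f {..<n}")
      case True
      have "f ` {..<n} = {..<n}" using f True by (intro endo_inj_surj) auto
      then show ?thesis using True chen_sum_relabel[of "re_cycle A" "{..<n}" f]
        by (simp add: re_cycle_rotate)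
    next
      case False
      then show ?thesis using f chen_sum_re_cycle_not_inj[OF assms, of "{..<n}" f] by auto
    qed
  qed auto
  also have "\<dots> = of_nat (card ?I) * chen_sum (re_cycle A) {..<n}"
    by (subst sum.inter_filter[symmetric]) (auto intro: finite_PiE)
  finally show ?thesis .
qed

section \<open>Unitary matrices\<close>

lemma dq_adjoint_carrier: "A \<in> carrier_mat n m \<Longrightarrow> dq_adjoint A \<in> carrier_mat m n"
  by (simp add: dq_adjoint_def)

lemma dq_adjoint_dq_adjoint [simp]: "dq_adjoint (dq_adjoint A) = A"
  by (auto simp: dq_adjoint_def)

lemma dq_adjoint_mult:
  assumes "A \<in> carrier_mat n m" "B \<in> carrier_mat m k"
  shows "dq_adjoint (A * B) = dq_adjoint B * dq_adjoint A"
  using assms by (intro eq_matI) (auto simp: dq_adjoint_def scalar_prod_def dqcnj_sum dqcnj_mult)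

lemma dq_hermitian_diff:
  assumes "A \<in> carrier_mat n n" "B \<in> carrier_mat n n" "dq_hermitian A" "dq_hermitian B"
  shows "dq_hermitian (A - B)"
  unfolding dq_hermitian_def
proof (rule eq_matI)
  fix i j assume "i < dim_row (A - B)" "j < dim_col (A - B)"
  then show "dq_adjoint (A - B) $$ (i, j) = (A - B) $$ (i, j)"
    using assms dq_hermitian_index[of A n i j] dq_hermitian_index[of B n i j]
    by (simp add: dq_adjoint_def dqcnj_diff)
qed (use assms in \<open>auto simp: dq_adjoint_def\<close>)

text \<open>The trace of \<open>N = N N\<^sup>*\<close> has as standard real part the sum of the squared norms of the
  standard parts of all entries. So these standard parts vanish, every entry is a multiple of
  \<open>\<epsilon>\<close>, and \<open>N = N N\<close> vanishes because \<open>\<epsilon>\<^sup>2 = 0\<close>.\<close>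

lemma projection_eq_0_if_re_trace_eq_0:
  assumes N: "N \<in> carrier_mat n n" and herm: "dq_hermitian N" and idem: "N * N = N"
    and tr: "re_trace N = 0"
  shows "N = 0\<^sub>m n n"
proof -
  let ?q = "\<lambda>x. (qRe (dq_std x))\<^sup>2 + (qI (dq_std x))\<^sup>2 + (qJ (dq_std x))\<^sup>2 + (qK (dq_std x))\<^sup>2"
  have entry: "N $$ (i, j) = (\<Sum>k<n. N $$ (i, k) * N $$ (k, j))" if "i < n" "j < n" for i j
    using arg_cong[OF idem, of "\<lambda>M. M $$ (i, j)"] N that
    by (simp add: scalar_prod_def atLeast0LessThan)
  have dn_std_sum: "dn_std (sum f I) = (\<Sum>x\<in>I. dn_std (f x))" for f :: "nat \<Rightarrow> dual_number" and I
    by (induction I rule: infinite_finite_induct) (simp_all add: dual_number_ops)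
  have sq: "dn_std (re_dual (x * dqcnj x)) = ?q x" for x
    by (simp add: re_dual_def dqcnj_def qcnj_def dquat_ops power2_eq_square)
  have "0 = dn_std (re_trace N)" using tr by (simp add: dual_number_ops)
  also have "\<dots> = (\<Sum>i<n. \<Sum>k<n. ?q (N $$ (i, k)))"
  proof -
    have "dn_std (re_dual (N $$ (i, i))) = (\<Sum>k<n. ?q (N $$ (i, k)))" if "i < n" for i
      unfolding entry[OF that that] re_dual_sum dn_std_sum
      by (intro sum.cong refl) (use dq_hermitian_index[OF herm N _ that] sq in auto)
    then show ?thesis using N by (simp add: re_trace_def dn_std_sum)
  qed
  finally have "(\<Sum>i<n. \<Sum>k<n. ?q (N $$ (i, k))) = 0" by simp
  then have "?q (N $$ (i, k)) = 0" if "i < n" "k < n" for i k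
    using that by (simp add: sum_nonneg_eq_0_iff sum_nonneg)
  then have std: "dq_std (N $$ (i, k)) = 0" if "i < n" "k < n" for i k
    using that by (fastforce simp: zero_quat_def quat.expand add_nonneg_eq_0_iff)
  have "x * y = 0" if "dq_std x = 0" "dq_std y = 0" for x y :: dquat
    using that by (simp add: times_dquat_def zero_dquat_def)
  then have "N $$ (i, j) = 0" if "i < n" "j < n" for i j
    unfolding entry[OF that] using std that by (intro sum.neutral) simp
  then show ?thesis using N by (intro eq_matI) auto
qed

lemma idempotent_complement:
  fixes P :: "'a::ring_1 mat"
  assumes P: "P \<in> carrier_mat n n" and idem: "P * P = P"
  shows "(1\<^sub>m n - P) * (1\<^sub>m n - P) = 1\<^sub>m n - P"
proof -
  have N: "1\<^sub>m n - P \<in> carrier_mat n n" using P by (rule minus_carrier_mat)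
  have "P * (1\<^sub>m n - P) = P * 1\<^sub>m n - P * P"
    using P by (intro mult_minus_distrib_mat) auto
  also have "\<dots> = 0\<^sub>m n n" using P by (simp add: idem)
  finally have "P * (1\<^sub>m n - P) = 0\<^sub>m n n" .
  moreover have "(1\<^sub>m n - P) * (1\<^sub>m n - P) = 1\<^sub>m n * (1\<^sub>m n - P) - P * (1\<^sub>m n - P)"
    using P N by (intro minus_mult_distrib_mat) auto
  moreover have "X - 0\<^sub>m n n = X" if "X \<in> carrier_mat n n" for X :: "'a mat"
    by (rule eq_matI) (use that in auto)
  ultimately show ?thesis using N by (simp only: left_mult_one_mat[OF N])
qed

text \<open>The matrix \<open>I - U U\<^sup>*\<close> is a Hermitian idempotent, and its real trace is that of
  \<open>I - U\<^sup>* U = 0\<close>.\<close>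

lemma dq_unitary_mult_adjoint:
  assumes U: "U \<in> carrier_mat n n" and "dq_unitary U"
  shows "U * dq_adjoint U = 1\<^sub>m n"
proof -
  let ?V = "dq_adjoint U" and ?P = "U * dq_adjoint U"
  define N where "N = 1\<^sub>m n - ?P"
  have V: "?V \<in> carrier_mat n n" using U by (rule dq_adjoint_carrier)
  have VU: "?V * U = 1\<^sub>m n" using assms by (simp add: dq_unitary_def)
  have P: "?P \<in> carrier_mat n n" using U V by auto
  then have N: "N \<in> carrier_mat n n" unfolding N_def by (rule minus_carrier_mat)
  \<comment> \<open>\<open>I - U U\<^sup>*\<close> inherits being Hermitian and idempotent from \<open>U U\<^sup>*\<close>.\<close>
  have "dq_adjoint ?P = ?P" using dq_adjoint_mult[OF U V] by simp
  then have "dq_hermitian ?P" by (simp add: dq_hermitian_def)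
  moreover have "dq_hermitian (1\<^sub>m n)" by (auto simp: dq_hermitian_def dq_adjoint_def)
  ultimately have "dq_hermitian N" unfolding N_def using P by (intro dq_hermitian_diff) auto
  moreover have "?P * ?P = U * (?V * U) * ?V"
    using U V by (simp add: assoc_mult_mat[of _ n n _ n _ n])
  then have "?P * ?P = ?P" using U by (simp add: VU)
  then have "N * N = N" unfolding N_def by (rule idempotent_complement[OF P])
  moreover have "re_trace N = 0"
  proof -
    have "re_trace N = re_trace (1\<^sub>m n) - re_trace ?P"
      unfolding N_def using P by (intro re_trace_diff) auto
    then show ?thesis using re_trace_mult_commute[OF U V] by (simp add: VU)
  qed
  ultimately have "N = 0\<^sub>m n n" using projection_eq_0_if_re_trace_eq_0[OF N] by blast
  have "?P $$ (i, j) = 1\<^sub>m n $$ (i, j)" if "i < n" "j < n" for i j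
  proof -
    have "N $$ (i, j) = 1\<^sub>m n $$ (i, j) - ?P $$ (i, j)"
      unfolding N_def using carrier_matD[OF P] that by (intro index_minus_mat) simp_all
    then show ?thesis using \<open>N = 0\<^sub>m n n\<close> that by simp
  qed
  then show ?thesis using P by (intro eq_matI) auto
qed

section \<open>Unitary invariance\<close>

theorem theorem3p8:
  fixes n :: nat and A U :: "dquat mat"
  assumes "n \<ge> 1"
    and "A \<in> carrier_mat n n" and "dq_hermitian A"
    and "U \<in> carrier_mat n n" and "dq_unitary U"
  shows "Cdet (dq_adjoint U * A * U) = Cdet A"
proof -
  note A = assms(2) and U = assms(4)
  let ?V = "dq_adjoint U"
  define B where "B = ?V * A * U"
  have V: "?V \<in> carrier_mat n n" using U by (rule dq_adjoint_carrier)
  have B: "B \<in> carrier_mat n n" using A U V by (auto simp: B_def)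
  have "dq_adjoint B = ?V * (A * U)"
    using A U V assms(3)
    by (simp add: B_def dq_adjoint_mult[of _ n n _ n] dq_hermitian_def)
  then have hermB: "dq_hermitian B"
    using A U V by (simp add: dq_hermitian_def B_def assoc_mult_mat[of _ n n _ n _ n])
  have UV: "U * ?V = 1\<^sub>m n" using U assms(5) by (rule dq_unitary_mult_adjoint)
  have VU: "?V * U = 1\<^sub>m n" using U assms(5) by (simp add: dq_unitary_def)
  have "similar_mat_wit B A ?V U"
    using A B U V UV VU by (simp add: similar_mat_wit_def B_def Let_def)
  then have pow: "B ^\<^sub>m k = ?V * A ^\<^sub>m k * U" for k
    by (rule similar_mat_wit_pow_id)
  have tr: "re_trace (B ^\<^sub>m k) = re_trace (A ^\<^sub>m k)" for k
  proof -
    have Ak: "A ^\<^sub>m k \<in> carrier_mat n n" using A by simp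
    have "re_trace (B ^\<^sub>m k) = re_trace (U * (?V * A ^\<^sub>m k))"
      unfolding pow using U V Ak by (intro re_trace_mult_commute[of _ n n]) auto
    also have "U * (?V * A ^\<^sub>m k) = (U * ?V) * A ^\<^sub>m k"
      using U V Ak by (intro assoc_mult_mat[symmetric])
    also have "\<dots> = A ^\<^sub>m k" using left_mult_one_mat[OF Ak] UV by simp
    finally show ?thesis .
  qed
  let ?N = "card {f \<in> {..<n} \<rightarrow>\<^sub>E {..<n}. inj_on f {..<n}}"
  have "restrict id {..<n} \<in> {f \<in> {..<n} \<rightarrow>\<^sub>E {..<n}. inj_on f {..<n}}"
    by (auto simp: inj_on_def)
  then have "{f \<in> {..<n} \<rightarrow>\<^sub>E {..<n}. inj_on f {..<n}} \<noteq> {}" by blast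
  moreover have "finite ({..<n} \<rightarrow>\<^sub>E {..<n})" by (intro finite_PiE) auto
  ultimately have "0 < ?N" by (simp add: card_gt_0_iff)
  moreover have "of_nat ?N * chen_sum (re_cycle B) {..<n} = of_nat ?N * chen_sum (re_cycle A) {..<n}"
    using total_chen_sum_eq_if_re_trace_eq[OF B A tr, of "{..<n}"]
      total_chen_sum_hermitian[OF hermB B] total_chen_sum_hermitian[OF assms(3) A] by simp
  ultimately have "chen_sum (re_cycle B) {..<n} = chen_sum (re_cycle A) {..<n}"
    using of_nat_mult_left_cancel_dual_number by blast
  then have "chen_sum (cycle_product B) {..<n} = chen_sum (cycle_product A) {..<n}"
    using chen_sum_cycle_product_hermitian[OF hermB B] chen_sum_cycle_product_hermitian[OF assms(3) A]
    by simp
  then show ?thesis using A B by (simp add: Cdet_eq_chen_sum flip: B_def)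
qed

end
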